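(* Let $X$ and $Y$ be Banach spaces and let $\alpha$ be a cross-norm on $X\odot Y$ such that $B_{X^*}\otimes_{\alpha^*}B_{Y^*}=B_{(X\otimes_\alpha Y)^*}$. Let $\{x_k\}_{k\ge1}$ be a bounded sequence in $X$. Then the following assertions are equivalent: (i) for any bounded sequence $\{y_k\}_{k\ge1}$ in $Y$, the sequence $\{x_k\otimes y_k\}$ in $X\otimes_\alpha Y$ is uniformly weakly mixing to zero; (ii) $\{x_k\}$ is uniformly weakly mixing to zero.
   Context: For a Banach space $Z$, $Z^*$ is its dual and $B_Z=\{z\in Z:\|z\|\le 1\}$. $X\odot Y$ is the algebraic tensor product; $X\otimes_\alpha Y$ is its completion with respect to the cross-norm $\alpha$ (i.e. $\alpha(x\otimes y)=\|x\|\|y\|$). $\alpha^*$ is the conjugate (dual) norm on $X^*\odot Y^*$, $\alpha^*(\varphi)=\sup\{|\varphi(u)|:u\in X\odot Y,\ \alpha(u)\le1\}$, where $(f\otimes g)(x\otimes y)=f(x)g(y)$; it is part of the setting that $\alpha^*$ is (finite and) a cross-norm. Thus $X^*\odot Y^*$ with $\alpha^*$ sits isometrically in $(X\otimes_\alpha Y)^*$. $B_{X^*}\odot B_{Y^*}=\{\sum_{k=1}^n\lambda_k f_k\otimes g_k:\ n\in\mathbb N,\ f_k\in B_{X^*},\ g_k\in B_{Y^*},\ \lambda_k\ge0,\ \sum_{k=1}^n\lambda_k\le1\}$, and $B_{X^*}\otimes_{\alpha^*}B_{Y^*}$ is the closure of $B_{X^*}\odot B_{Y^*}$ with respect to $\alpha^*$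 (regarded as a subset of $(X\otimes_\alpha Y)^*$). A sequence $\{z_k\}_{k\ge1}$ in a Banach space $Z$ is uniformly weakly mixing to zero if $\lim_{n\to\infty}\sup\{\frac1n\sum_{k=1}^n|f(z_k)|: f\in B_{Z^*}\}=0$.
   Formalization: The Banach space Y is assumed to be nonzero; for Y = {0} the equivalence fails, since (i) holds trivially while a constant nonzero sequence in X violates (ii). *)

theory Defs
  imports "HOL-Analysis.Analysis"
begin

text \<open>The field of scalars: a normed field that is either \<open>\<real>\<close> (take \<open>i = 0\<close>) or \<open>\<complex>\<close>. Since
  the norm of a \<open>real_normed_field\<close> is multiplicative, it is the usual absolute value.\<close>

class real_or_complex = real_normed_field +
  assumes real_or_complex:
    "\<exists>i. (i = 0 \<or> i * i = - 1) \<and> (\<forall>z. \<exists>a b. z = a *\<^sub>R 1 + b *\<^sub>R i)"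

instance real :: real_or_complex
proof
  have "z = z *\<^sub>R 1 + 0 *\<^sub>R 0" for z :: real
    by simp
  then show "\<exists>i::real. (i = 0 \<or> i * i = - 1) \<and> (\<forall>z. \<exists>a b. z = a *\<^sub>R 1 + b *\<^sub>R i)"
    by blast
qed

instance complex :: real_or_complex
proof
  have "z = Re z *\<^sub>R 1 + Im z *\<^sub>R \<i>" for z
    by (simp add: complex_eq_iff)
  then show "\<exists>i::complex. (i = 0 \<or> i * i = - 1) \<and> (\<forall>z. \<exists>a b. z = a *\<^sub>R 1 + b *\<^sub>R i)"
    by (intro exI[of _ \<i>] conjI disjI2 allI i_squared) blast
qed

text \<open>A Banach space over such a field, with scalar multiplication \<open>scale\<close>.\<close>

locale banach_space_over = vector_space scale
  for scale :: "'k::real_or_complex \<Rightarrow> 'v::banach \<Rightarrow> 'v" +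
  assumes scale_of_real: "scale (of_real r) v = r *\<^sub>R v"
    and norm_scale: "norm (scale c v) = norm c * norm v"

lemma banach_space_over_real: "banach_space_over (scaleR :: real \<Rightarrow> 'v::banach \<Rightarrow> 'v)"
  by unfold_locales (simp_all add: algebra_simps)

lemma banach_space_over_self:
  "banach_space_over ((*) :: 'k::{real_or_complex,banach} \<Rightarrow> 'k \<Rightarrow> 'k)"
  by unfold_locales (simp_all add: algebra_simps norm_mult scaleR_conv_of_real)

definition dual_space :: "('k::real_or_complex \<Rightarrow> 'v::banach \<Rightarrow> 'v) \<Rightarrow> ('v \<Rightarrow> 'k) set" where
  "dual_space s = {f. Vector_Spaces.linear s (*) f \<and> bounded_linear f}"

definition dual_ball :: "('k::real_or_complex \<Rightarrow> 'v::banach \<Rightarrow> 'v) \<Rightarrow> ('v \<Rightarrow> 'k) set" where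
  "dual_ball s = {f \<in> dual_space s. onorm f \<le> 1}"

text \<open>Sequences are indexed by \<open>k \<ge> 1\<close>; the value at \<open>0\<close> is ignored.\<close>

definition uniformly_weakly_mixing_to_zero ::
    "('k::real_or_complex \<Rightarrow> 'v::banach \<Rightarrow> 'v) \<Rightarrow> (nat \<Rightarrow> 'v) \<Rightarrow> bool" where
  "uniformly_weakly_mixing_to_zero s z \<longleftrightarrow>
    (\<lambda>n. SUP f\<in>dual_ball s. (1 / real n) * (\<Sum>k=1..n. norm (f (z k)))) \<longlonglongrightarrow> 0"

text \<open>The algebraic tensor product \<open>X \<odot> Y\<close> is realised in the dual of the space of all bilinear forms
  on \<open>X \<times> Y\<close>, where \<open>x \<otimes> y\<close> is evaluation at \<open>(x, y)\<close>. Functions that are not bilinear forms are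
  sent to \<open>0\<close>, so that equality of tensors is equality of HOL functions. Scalars in a linear
  combination of elementary tensors are absorbed into the first factor.\<close>

definition bilinear_form ::
    "('k::real_or_complex \<Rightarrow> 'x::banach \<Rightarrow> 'x) \<Rightarrow> ('k \<Rightarrow> 'y::banach \<Rightarrow> 'y) \<Rightarrow> ('x \<Rightarrow> 'y \<Rightarrow> 'k) \<Rightarrow> bool" where
  "bilinear_form sX sY b \<longleftrightarrow>
    (\<forall>y. Vector_Spaces.linear sX (*) (\<lambda>x. b x y)) \<and> (\<forall>x. Vector_Spaces.linear sY (*) (\<lambda>y. b x y))"

type_synonym ('k, 'x, 'y) tensor = "('x \<Rightarrow> 'y \<Rightarrow> 'k) \<Rightarrow> 'k"

definition elem_tensor ::
    "('k::real_or_complex \<Rightarrow> 'x::banach \<Rightarrow> 'x) \<Rightarrow> ('k \<Rightarrow> 'y::banach \<Rightarrow> 'y) \<Rightarrow> 'x \<Rightarrow> 'y \<Rightarrow> ('k, 'x, 'y) tensor" where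
  "elem_tensor sX sY x y = (\<lambda>b. if bilinear_form sX sY b then b x y else 0)"

definition alg_tensor ::
    "('k::real_or_complex \<Rightarrow> 'x::banach \<Rightarrow> 'x) \<Rightarrow> ('k \<Rightarrow> 'y::banach \<Rightarrow> 'y) \<Rightarrow> ('k, 'x, 'y) tensor set" where
  "alg_tensor sX sY =
    {u. \<exists>(n::nat) x y. u = (\<lambda>b. \<Sum>k<n. elem_tensor sX sY (x k) (y k) b)}"

text \<open>\<open>N\<close> is a norm on \<open>V\<close>, a space of scalar functions with pointwise operations.\<close>

definition norm_on :: "('p \<Rightarrow> 'k::real_or_complex) set \<Rightarrow> (('p \<Rightarrow> 'k) \<Rightarrow> real) \<Rightarrow> bool" where
  "norm_on V N \<longleftrightarrow>
    (\<forall>u\<in>V. 0 \<le> N u) \<and>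
    (\<forall>u\<in>V. N u = 0 \<longleftrightarrow> u = (\<lambda>p. 0)) \<and>
    (\<forall>u\<in>V. \<forall>c. N (\<lambda>p. c * u p) = norm c * N u) \<and>
    (\<forall>u\<in>V. \<forall>v\<in>V. N (\<lambda>p. u p + v p) \<le> N u + N v)"

definition cross_norm ::
    "('k::real_or_complex \<Rightarrow> 'x::banach \<Rightarrow> 'x) \<Rightarrow> ('k \<Rightarrow> 'y::banach \<Rightarrow> 'y) \<Rightarrow> (('k, 'x, 'y) tensor \<Rightarrow> real) \<Rightarrow> bool" where
  "cross_norm sX sY \<alpha> \<longleftrightarrow>
    norm_on (alg_tensor sX sY) \<alpha> \<and> (\<forall>x y. \<alpha> (elem_tensor sX sY x y) = norm x * norm y)"

text \<open>\<open>f \<otimes> g\<close> as a functional on \<open>X \<odot> Y\<close>: a tensor \<open>u\<close> is evaluated at the bilinear form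
  \<open>(x, y) \<mapsto> f x * g y\<close>, whence \<open>(f \<otimes> g) (x \<otimes> y) = f x * g y\<close>. The value is set to \<open>0\<close> off \<open>X \<odot> Y\<close>, so
  that equality of functionals on \<open>X \<odot> Y\<close> is equality of HOL functions. Elements of \<open>X\<^sup>* \<odot> Y\<^sup>*\<close> are
  identified with the functionals on \<open>X \<odot> Y\<close> they induce.\<close>

definition elem_functional ::
    "('k::real_or_complex \<Rightarrow> 'x::banach \<Rightarrow> 'x) \<Rightarrow> ('k \<Rightarrow> 'y::banach \<Rightarrow> 'y) \<Rightarrow>
      ('x \<Rightarrow> 'k) \<Rightarrow> ('y \<Rightarrow> 'k) \<Rightarrow> ('k, 'x, 'y) tensor \<Rightarrow> 'k" where
  "elem_functional sX sY f g =
    (\<lambda>u. if u \<in> alg_tensor sX sY then u (\<lambda>x y. f x * g y) else 0)"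

lemma elem_functional_elem_tensor:
  assumes "banach_space_over sX" "banach_space_over sY" "f \<in> dual_space sX" "g \<in> dual_space sY"
  shows "elem_functional sX sY f g (elem_tensor sX sY x y) = f x * g y"
proof -
  have "bilinear_form sX sY (\<lambda>x y. f x * g y)"
    using assms
    by (auto simp: bilinear_form_def dual_space_def Vector_Spaces.linear_iff algebra_simps)
  moreover have "elem_tensor sX sY x y \<in> alg_tensor sX sY"
    unfolding alg_tensor_def
    by (auto intro!: exI[of _ "1::nat"] exI[of _ "\<lambda>_. x"] exI[of _ "\<lambda>_. y"])
  ultimately show ?thesis
    by (simp add: elem_functional_def elem_tensor_def)
qed

definition dual_alg_tensor ::
    "('k::real_or_complex \<Rightarrow> 'x::banach \<Rightarrow> 'x) \<Rightarrow> ('k \<Rightarrow> 'y::banach \<Rightarrow> 'y) \<Rightarrow> (('k, 'x, 'y) tensor \<Rightarrow> 'k) set" where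
  "dual_alg_tensor sX sY =
    {\<phi>. \<exists>(n::nat) f g. (\<forall>k<n. f k \<in> dual_space sX \<and> g k \<in> dual_space sY) \<and>
          \<phi> = (\<lambda>u. \<Sum>k<n. elem_functional sX sY (f k) (g k) u)}"

definition conj_norm ::
    "('k::real_or_complex \<Rightarrow> 'x::banach \<Rightarrow> 'x) \<Rightarrow> ('k \<Rightarrow> 'y::banach \<Rightarrow> 'y) \<Rightarrow> (('k, 'x, 'y) tensor \<Rightarrow> real) \<Rightarrow>
      (('k, 'x, 'y) tensor \<Rightarrow> 'k) \<Rightarrow> real" where
  "conj_norm sX sY \<alpha> \<phi> = (SUP u\<in>{u \<in> alg_tensor sX sY. \<alpha> u \<le> 1}. norm (\<phi> u))"

text \<open>\<open>\<alpha>\<^sup>*\<close> is a finite cross-norm on \<open>X\<^sup>* \<odot> Y\<^sup>*\<close>. Finiteness has to be required explicitly because the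
  supremum of an unbounded set of reals is unspecified.\<close>

definition conj_cross_norm ::
    "('k::real_or_complex \<Rightarrow> 'x::banach \<Rightarrow> 'x) \<Rightarrow> ('k \<Rightarrow> 'y::banach \<Rightarrow> 'y) \<Rightarrow> (('k, 'x, 'y) tensor \<Rightarrow> real) \<Rightarrow> bool" where
  "conj_cross_norm sX sY \<alpha> \<longleftrightarrow>
    (\<forall>\<phi>\<in>dual_alg_tensor sX sY. bdd_above ((\<lambda>u. norm (\<phi> u)) ` {u \<in> alg_tensor sX sY. \<alpha> u \<le> 1})) \<and>
    norm_on (dual_alg_tensor sX sY) (conj_norm sX sY \<alpha>) \<and>
    (\<forall>f\<in>dual_space sX. \<forall>g\<in>dual_space sY.
       conj_norm sX sY \<alpha> (elem_functional sX sY f g) = onorm f * onorm g)"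

text \<open>The Banach space \<open>'w\<close> with scalar multiplication \<open>sW\<close>, together with the isometric embedding
  \<open>\<iota>\<close>, is the completion of \<open>V\<close> with respect to the norm \<open>N\<close>; it is unique up to isometric
  isomorphism.\<close>

definition is_completion ::
    "('p \<Rightarrow> 'k::real_or_complex) set \<Rightarrow> (('p \<Rightarrow> 'k) \<Rightarrow> real) \<Rightarrow>
      ('k \<Rightarrow> 'w::banach \<Rightarrow> 'w) \<Rightarrow> (('p \<Rightarrow> 'k) \<Rightarrow> 'w) \<Rightarrow> bool" where
  "is_completion V N sW \<iota> \<longleftrightarrow>
    banach_space_over sW \<and>
    (\<forall>u\<in>V. \<forall>v\<in>V. \<iota> (\<lambda>p. u p + v p) = \<iota> u + \<iota> v) \<and>
    (\<forall>u\<in>V. \<forall>c. \<iota> (\<lambda>p. c * u p) = sW c (\<iota> u)) \<and>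
    (\<forall>u\<in>V. norm (\<iota> u) = N u) \<and>
    closure (\<iota> ` V) = UNIV"

definition ball_alg_tensor ::
    "('k::real_or_complex \<Rightarrow> 'x::banach \<Rightarrow> 'x) \<Rightarrow> ('k \<Rightarrow> 'y::banach \<Rightarrow> 'y) \<Rightarrow> (('k, 'x, 'y) tensor \<Rightarrow> 'k) set" where
  "ball_alg_tensor sX sY =
    {\<phi>. \<exists>(n::nat) c f g.
          (\<forall>k<n. f k \<in> dual_ball sX \<and> g k \<in> dual_ball sY \<and> (0::real) \<le> c k) \<and> (\<Sum>k<n. c k) \<le> 1 \<and>
          \<phi> = (\<lambda>u. \<Sum>k<n. of_real (c k) * elem_functional sX sY (f k) (g k) u)}"

text \<open>The \<open>\<alpha>\<^sup>*\<close>-closure of \<open>ball_alg_tensor\<close> in the dual of the completion. An element \<open>\<psi>\<close> of that dual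
  is compared with functionals on \<open>X \<odot> Y\<close> through its restriction \<open>\<psi> \<circ> \<iota>\<close>. By density of \<open>\<iota> ` (X \<odot> Y)\<close>,
  the norm \<open>\<alpha>\<^sup>*\<close> is the operator norm of the dual.\<close>

definition ball_tensor_closure ::
    "('k::real_or_complex \<Rightarrow> 'x::banach \<Rightarrow> 'x) \<Rightarrow> ('k \<Rightarrow> 'y::banach \<Rightarrow> 'y) \<Rightarrow> (('k, 'x, 'y) tensor \<Rightarrow> real) \<Rightarrow>
      ('k \<Rightarrow> 'w::banach \<Rightarrow> 'w) \<Rightarrow> (('k, 'x, 'y) tensor \<Rightarrow> 'w) \<Rightarrow> ('w \<Rightarrow> 'k) set" where
  "ball_tensor_closure sX sY \<alpha> sW \<iota> =
    {\<psi> \<in> dual_space sW. \<forall>\<epsilon>>0. \<exists>\<phi>\<in>ball_alg_tensor sX sY.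
        conj_norm sX sY \<alpha> (\<lambda>u. \<psi> (\<iota> u) - \<phi> u) < \<epsilon>}"

end

theory Submission imports Defs begin

text \<open>For (ii) \<open>\<Longrightarrow>\<close> (i), a functional \<open>\<psi>\<close> in the dual ball of \<open>X \<otimes>\<^sub>\<alpha> Y\<close> is approximated by a subconvex
  combination of functionals \<open>f \<otimes> g\<close>; since \<open>\<bar>f x\<^sub>k\<bar> \<bar>g y\<^sub>k\<bar> \<le> M \<bar>f x\<^sub>k\<bar>\<close> with \<open>M\<close> a bound on \<open>(y\<^sub>k)\<close>, the
  mixing mean of \<open>(x\<^sub>k \<otimes> y\<^sub>k)\<close> is at most \<open>M\<close> times that of \<open>(x\<^sub>k)\<close>. For (i) \<open>\<Longrightarrow>\<close> (ii), take \<open>y\<^sub>k = y \<noteq> 0\<close>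
  constant. The map \<open>x \<otimes> y \<mapsto> \<parallel>y\<parallel> f x\<close> is a functional of norm at most \<open>1\<close> on the subspace \<open>X \<otimes> y\<close>, so
  by Hahn-Banach it extends to the dual ball of \<open>X \<otimes>\<^sub>\<alpha> Y\<close>.\<close>

section \<open>Hahn-Banach extension of real functionals dominated by a sublinear function\<close>

text \<open>Partial functionals are represented by their graphs, so that Zorn's lemma applies to inclusion of
  subspaces of the product; the bound by \<open>p\<close> forces such a subspace to be single-valued.\<close>

lemma hahn_banach_graph:
  fixes p :: "'v::real_vector \<Rightarrow> real" and G :: "('v \<times> real) set"
  assumes add: "\<And>x y. p (x + y) \<le> p x + p y"
    and scale: "\<And>t x. 0 < t \<Longrightarrow> p (t *\<^sub>R x) = t * p x"
    and "subspace G" and "\<And>x a. (x, a) \<in> G \<Longrightarrow> a \<le> p x"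
  obtains g where "linear g" "\<And>x. g x \<le> p x" "\<And>x a. (x, a) \<in> G \<Longrightarrow> g x = a"
proof -
  define \<A> where "\<A> = {H. subspace H \<and> G \<subseteq> H \<and> (\<forall>x a. (x, a) \<in> H \<longrightarrow> a \<le> p x)}"
  have G_in: "G \<in> \<A>"
    using assms by (auto simp: \<A>_def)
  have Union_in: "\<Union>\<C> \<in> \<A>" if "\<C> \<noteq> {}" "subset.chain \<A> \<C>" for \<C>
  proof -
    have sub: "subspace H" "G \<subseteq> H" "\<forall>x a. (x, a) \<in> H \<longrightarrow> a \<le> p x" if "H \<in> \<C>" for H
      using that \<open>subset.chain \<A> \<C>\<close> by (auto simp: \<A>_def subset_chain_def)
    have "subspace (\<Union>\<C>)"
    proof (rule subspaceI)
      show "0 \<in> \<Union>\<C>"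
        using sub(1) \<open>\<C> \<noteq> {}\<close> subspace_0 by blast
      show "u + v \<in> \<Union>\<C>" if uv: "u \<in> \<Union>\<C>" "v \<in> \<Union>\<C>" for u v
      proof -
        obtain H where "H \<in> \<C>" "u \<in> H" "v \<in> H"
          using uv \<open>subset.chain \<A> \<C>\<close> unfolding subset_chain_def by blast
        then show ?thesis
          using sub(1) subspace_add by blast
      qed
      show "c *\<^sub>R u \<in> \<Union>\<C>" if "u \<in> \<Union>\<C>" for c u
        using that sub(1) subspace_scale by blast
    qed
    then show ?thesis
      using sub \<open>\<C> \<noteq> {}\<close> by (auto simp: \<A>_def)
  qed
  obtain M where M: "M \<in> \<A>" and max: "\<And>H. H \<in> \<A> \<Longrightarrow> M \<subseteq> H \<Longrightarrow> H = M"
    using subset_Zorn_nonempty[of \<A>] G_in Union_in by blast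
  have sM: "subspace M" and GM: "G \<subseteq> M" and bM: "\<And>x a. (x, a) \<in> M \<Longrightarrow> a \<le> p x"
    using M by (auto simp: \<A>_def)
  have p0: "p 0 \<le> 0"
    using scale[of 2 0] by simp
  \<comment> \<open>The differences of two values over \<open>x\<close> lie over 0, and
    \<open>p0\<close> caps everything over 0 by 0, in both directions.\<close>
  have unique: "a = b" if "(x, a) \<in> M" "(x, b) \<in> M" for x a b
  proof -
    have "a - b \<le> p 0" "b - a \<le> p 0"
      using that subspace_diff[OF sM, of "(x, a)" "(x, b)"] subspace_diff[OF sM, of "(x, b)" "(x, a)"]
      by (auto intro: bM)
    then show ?thesis
      using p0 by linarith
  qed
  have total: "\<exists>a. (x0, a) \<in> M" for x0
  proof -
    \<comment> \<open>A value \<open>c\<close> at \<open>x0\<close> respects the bound for the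
      coefficients -1 and 1 of \<open>x0\<close> iff it lies above all of \<open>L\<close> and below
      all \<open>p (y + x0) - b\<close>; \<open>le\<close> separates the two families, so
      \<open>Sup L\<close> qualifies.\<close>
    define L where "L = (\<lambda>(x, a). a - p (x - x0)) ` M"
    have le: "a - p (x - x0) \<le> p (y + x0) - b" if "(x, a) \<in> M" "(y, b) \<in> M" for x y a b
    proof -
      have "a + b \<le> p (x + y)"
        using that subspace_add[OF sM, of "(x, a)" "(y, b)"] by (auto intro: bM)
      also have "\<dots> \<le> p (x - x0) + p (y + x0)"
        using add[of "x - x0" "y + x0"] by simp
      finally show ?thesis by simp
    qed
    have M0: "(0, 0) \<in> M"
      using subspace_0[OF sM] by (simp add: zero_prod_def)
    have bdd: "bdd_above L"
      unfolding L_def bdd_above_def using le[OF _ M0] by (intro exI[of _ "p (0 + x0) - 0"]) auto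
    define c where "c = Sup L"
    have lower: "a - p (x - x0) \<le> c" if "(x, a) \<in> M" for x a
      unfolding c_def by (rule cSup_upper[OF _ bdd]) (use that in \<open>force simp: L_def\<close>)
    have upper: "c \<le> p (y + x0) - b" if "(y, b) \<in> M" for y b
      unfolding c_def by (rule cSup_least) (use M0 le that in \<open>auto simp: L_def\<close>)
    \<comment> \<open>Membership in \<open>\<A>\<close> asks for the bound and not for
      single-valuedness, so no case distinction arises on whether \<open>x0\<close> already has a
      value in \<open>M\<close>.\<close>
    define H where "H = {u + v |u v. u \<in> M \<and> v \<in> span {(x0, c)}}"
    have "a + t * c \<le> p (x + t *\<^sub>R x0)" if xa: "(x, a) \<in> M" for x a t
    proof -
      \<comment> \<open>Dividing by the absolute value of \<open>t\<close> reduces the bound to the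
        coefficients 1 and -1, where \<open>upper\<close> and \<open>lower\<close> apply.\<close>
      have M': "((1 / s) *\<^sub>R x, a / s) \<in> M" for s
        using subspace_scale[OF sM xa, of "1 / s"] by simp
      consider "t = 0" | "t > 0" | "t < 0" by linarith
      then show ?thesis
      proof cases
        case 1
        then show ?thesis using bM[OF xa] by simp
      next
        case 2
        have "t * c \<le> t * (p ((1 / t) *\<^sub>R x + x0) - a / t)"
          using upper[OF M'[of t]] 2 by (intro mult_left_mono) auto
        also have "\<dots> = p (x + t *\<^sub>R x0) - a"
          using 2 by (simp add: scale[symmetric] algebra_simps)
        finally show ?thesis by simp
      next
        case 3
        define s where "s = - t"
        have s: "s > 0" "t = - s"
          using 3 by (auto simp: s_def)
        have "s * (a / s - p ((1 / s) *\<^sub>R x - x0)) \<le> s * c"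
          using lower[OF M'[of s]] s by (intro mult_left_mono) auto
        moreover have "s * (a / s - p ((1 / s) *\<^sub>R x - x0)) = a - p (x - s *\<^sub>R x0)"
          using s by (simp add: scale[symmetric] algebra_simps)
        ultimately show ?thesis using s by simp
      qed
    qed
    then have "\<forall>x a. (x, a) \<in> H \<longrightarrow> a \<le> p x"
      by (auto simp: H_def span_singleton)
    moreover have "subspace H"
      unfolding H_def by (intro subspace_sums sM subspace_span)
    moreover have MH: "M \<subseteq> H"
      unfolding H_def using span_zero by (metis (mono_tags, lifting) add.right_neutral mem_Collect_eq subsetI)
    ultimately have "H = M"
      using GM by (intro max) (auto simp: \<A>_def)
    moreover have "(x0, c) \<in> H"
      unfolding H_def using subspace_0[OF sM] span_base[of "(x0, c)" "{(x0, c)}"]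
      by (metis (mono_tags, lifting) add.left_neutral mem_Collect_eq singletonI)
    ultimately show ?thesis by blast
  qed
  define g where "g x = (THE a. (x, a) \<in> M)" for x
  have gI: "g x = a" if "(x, a) \<in> M" for x a
    unfolding g_def using that unique by blast
  have gM: "(x, g x) \<in> M" for x
    using total[of x] gI by blast
  show ?thesis
  proof (rule that)
    show "linear g"
    proof (rule linearI)
      show "g (x + y) = g x + g y" for x y
        using subspace_add[OF sM gM[of x] gM[of y]] by (intro gI) simp
      show "g (t *\<^sub>R x) = t *\<^sub>R g x" for t x
        using subspace_scale[OF sM gM[of x], of t] by (intro gI) simp
    qed
  qed (use gM bM gI GM in blast)+
qed

section \<open>Real parts of scalars and Hahn-Banach extension over the scalar field\<close>

text \<open>\<open>\<rho>\<close> is the real part, and \<open>i = 0\<close> lets the same formulas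
  serve the real case. The substance is the bound of \<open>\<rho>\<close> by the norm: in the
  complex case the class fixes the norm on real multiples of 1, and multiplicativity must determine
  the rest.\<close>

lemma real_or_complex_Re:
  obtains i :: "'k::real_or_complex" and \<rho> :: "'k \<Rightarrow> real"
  where "linear \<rho>" "\<And>z. z = of_real (\<rho> z) - i * of_real (\<rho> (i * z))"
    "\<And>a b. \<rho> (of_real a + i * of_real b) = a" "\<And>z. \<bar>\<rho> z\<bar> \<le> norm z" "i = 0 \<or> i * i = - 1"
proof -
  obtain i :: 'k where i: "i = 0 \<or> i * i = - 1"
    and ex: "\<And>z. \<exists>a b. z = of_real a + i * of_real b"
    using real_or_complex by (auto simp: scaleR_conv_of_real mult.commute)
  show ?thesis
  proof (cases "i = 0")
    case True
    define \<rho> where "\<rho> z = (THE a. z = of_real a)" for z :: 'k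
    have \<rho>: "\<rho> (of_real a) = a" for a
      by (simp add: \<rho>_def)
    have ex': "\<exists>a. z = of_real a" for z :: 'k
      using ex[of z] True by simp
    have z: "of_real (\<rho> z) = z" for z
      using ex'[of z] \<rho> by auto
    show ?thesis
    proof (rule that[of \<rho> 0])
      show "linear \<rho>"
      proof (rule linearI)
        show "\<rho> (u + v) = \<rho> u + \<rho> v" for u v
          by (metis z \<rho> of_real_add)
        show "\<rho> (t *\<^sub>R u) = t *\<^sub>R \<rho> u" for t u
          by (metis z \<rho> of_real_mult scaleR_conv_of_real real_scaleR_def)
      qed
      show "\<bar>\<rho> z\<bar> \<le> norm z" for z
        by (metis z norm_of_real order_refl)
    qed (simp_all add: z \<rho>)
  next
    case False
    then have ii: "i * i = - 1"
      using i by simp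
    \<comment> \<open>\<open>h\<close> identifies the complex numbers with the scalar field. Once it
      is isometric, its inverse \<open>r\<close> transports \<open>Re\<close> and its norm
      bound.\<close>
    define h where "h w = of_real (Re w) + i * of_real (Im w)" for w
    have h_mult: "h (v * w) = h v * h w" for v w
    proof -
      have "h v * h w = of_real (Re v * Re w) + i * of_real (Re v * Im w + Im v * Re w)
          + (i * i) * of_real (Im v * Im w)"
        by (simp add: h_def algebra_simps)
      then show ?thesis
        unfolding ii by (simp add: h_def algebra_simps)
    qed
    have h_1: "h 1 = 1"
      by (simp add: h_def)
    have h_power: "h (w ^ n) = h w ^ n" for w n
      by (induction n) (simp_all add: h_mult h_1)
    have "norm i * norm i = 1"
      using arg_cong[OF ii, of norm] by (simp add: norm_mult)
    then have norm_i: "norm i = 1"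
      using norm_ge_zero[of i] unfolding square_eq_1_iff by linarith
    have h_le2: "norm (h w) \<le> 2 * norm w" for w
      using norm_triangle_ineq[of "of_real (Re w)" "i * of_real (Im w)"]
        abs_Re_le_cmod[of w] abs_Im_le_cmod[of w]
      by (simp add: h_def norm_mult norm_i)
    \<comment> \<open>\<open>h\<close> is multiplicative, so applying the bound to the powers of \<open>w\<close> removes the factor 2.\<close>
    have h_le: "norm (h w) \<le> norm w" for w
    proof (rule ccontr)
      assume "\<not> ?thesis"
      then have less: "norm w < norm (h w)" by simp
      then have "h w \<noteq> 0"
        using norm_ge_zero[of w] by (metis norm_zero not_le)
      then have "w \<noteq> 0"
        by (auto simp: h_def)
      define q where "q = norm (h w) / norm w"
      have "q > 1"
        using less \<open>w \<noteq> 0\<close> by (simp add: q_def)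
      then obtain n where n: "2 < q ^ n"
        using real_arch_pow by blast
      have "q ^ n \<le> 2"
        using h_le2[of "w ^ n"] \<open>w \<noteq> 0\<close>
        by (simp add: q_def h_power norm_power power_divide divide_simps)
      with n show False by simp
    qed
    \<comment> \<open>Since \<open>w\<close> times its conjugate is real, the norms of the two
      images multiply to the square of \<open>norm w\<close>; the upper bound \<open>h_le\<close> on
      one factor forces a lower bound on the other.\<close>
    have h_ge: "norm w \<le> norm (h w)" for w
    proof (cases "w = 0")
      case False
      have "h w * h (cnj w) = of_real (norm w ^ 2)"
        by (simp add: h_mult[symmetric] complex_norm_square[symmetric]) (simp add: h_def flip: of_real_power)
      then have "norm (h w) * norm (h (cnj w)) = norm w ^ 2"
        by (metis norm_mult norm_of_real abs_power2)
      then have "norm w * norm w \<le> norm (h w) * norm w"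
        using h_le[of "cnj w"] by (metis complex_mod_cnj mult_left_mono norm_ge_zero power2_eq_square)
      then show ?thesis
        using False by simp
    qed simp
    have h_inj: "h v = h w \<longleftrightarrow> v = w" for v w
      using h_ge[of "v - w"] by (auto simp: h_def algebra_simps)
    define r where "r z = (THE w. h w = z)" for z
    have r_h: "r (h w) = w" for w
      by (simp add: r_def h_inj)
    have ex_h: "\<exists>w. z = h w" for z
      using ex[of z] by (metis h_def complex.sel)
    have h_r: "h (r z) = z" for z
      using ex_h[of z] r_h by auto
    have h_ab: "of_real a + i * of_real b = h (Complex a b)" for a b
      by (simp add: h_def)
    have i_h: "i = h \<i>"
      by (simp add: h_def)
    show ?thesis
    proof (rule that[of "\<lambda>z. Re (r z)" i])
      have "h (v + w) = h v + h w" "h (t *\<^sub>R v) = t *\<^sub>R h v" for v w t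
        by (simp_all add: h_def scaleR_conv_of_real algebra_simps)
      then have "r (u + v) = r u + r v" "r (t *\<^sub>R u) = t *\<^sub>R r u" for u v t
        by (metis h_r r_h)+
      then show "linear (\<lambda>z. Re (r z))"
        by (intro linearI) simp_all
      show "z = of_real (Re (r z)) - i * of_real (Re (r (i * z)))" for z
      proof -
        have "r (i * z) = \<i> * r z"
          by (metis h_mult h_r i_h r_h)
        then show ?thesis
          using h_r[of z] by (simp add: h_def)
      qed
      show "\<bar>Re (r z)\<bar> \<le> norm z" for z
        using abs_Re_le_cmod[of "r z"] h_ge[of "r z"] by (simp add: h_r)
    qed (use ii in \<open>simp_all add: h_ab r_h\<close>)
  qed
qed

text \<open>The real part of the functional is extended as a real functional \<open>R\<close>, and
  \<open>\<psi>\<close> is recovered from \<open>R\<close> as a scalar is from its real part. The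
  bound together with closure under the operations forces \<open>G\<close> to be single-valued, so a
  caller may give \<open>G\<close> as a bare set of pairs.\<close>

lemma hahn_banach_over:
  fixes s :: "'k::real_or_complex \<Rightarrow> 'v::banach \<Rightarrow> 'v" and G :: "('v \<times> 'k) set"
  assumes s: "banach_space_over s" and "0 \<le> C" and zero: "(0, 0) \<in> G"
    and add: "\<And>v w a b. (v, a) \<in> G \<Longrightarrow> (w, b) \<in> G \<Longrightarrow> (v + w, a + b) \<in> G"
    and scale: "\<And>c v a. (v, a) \<in> G \<Longrightarrow> (s c v, c * a) \<in> G"
    and bound: "\<And>v a. (v, a) \<in> G \<Longrightarrow> norm a \<le> C * norm v"
  obtains \<psi> where "\<psi> \<in> dual_space s" "\<And>v. norm (\<psi> v) \<le> C * norm v" "\<And>v a. (v, a) \<in> G \<Longrightarrow> \<psi> v = a"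
proof -
  interpret B: banach_space_over s by (rule s)
  obtain \<rho> and i :: 'k where \<rho>: "linear \<rho>" and \<rho>_decomp: "\<And>z. z = of_real (\<rho> z) - i * of_real (\<rho> (i * z))"
    and \<rho>_of_real: "\<And>a b. \<rho> (of_real a + i * of_real b) = a" and \<rho>_le: "\<And>z. \<bar>\<rho> z\<bar> \<le> norm z"
    and i: "i = 0 \<or> i * i = - 1"
    by (rule real_or_complex_Re) (rule that; assumption)
  define G' where "G' = {(v, \<rho> a) |v a. (v, a) \<in> G}"
  have "subspace G'"
  proof (rule subspaceI)
    show "0 \<in> G'"
      unfolding G'_def using zero linear_0[OF \<rho>] by (force simp: zero_prod_def)
    show "u + w \<in> G'" if "u \<in> G'" "w \<in> G'" for u w
      using that add unfolding G'_def by (force simp: linear_add[OF \<rho>, symmetric])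
    show "r *\<^sub>R u \<in> G'" if u: "u \<in> G'" for r u
    proof -
      obtain v a where va: "(v, a) \<in> G" "u = (v, \<rho> a)"
        using u unfolding G'_def by blast
      then have "r *\<^sub>R u = (s (of_real r) v, \<rho> (of_real r * a))"
        using linear_scale[OF \<rho>, of r a] by (simp add: B.scale_of_real scaleR_conv_of_real)
      then show ?thesis
        unfolding G'_def using scale[OF va(1), of "of_real r"] by force
    qed
  qed
  moreover have "a \<le> C * norm v" if va: "(v, a) \<in> G'" for v a
  proof -
    obtain b where "(v, b) \<in> G" "a = \<rho> b"
      using va unfolding G'_def by auto
    then show ?thesis
      using \<rho>_le[of b] bound[of v b] by linarith
  qed
  moreover have "C * norm (v + w) \<le> C * norm v + C * norm w" for v w :: 'v
    using \<open>0 \<le> C\<close> norm_triangle_ineq[of v w] by (metis distrib_left mult_left_mono)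
  moreover have "C * norm (t *\<^sub>R v) = t * (C * norm v)" if "0 < t" for t and v :: 'v
    using that by simp
  ultimately obtain R where R: "linear R" and R_le: "\<And>v. R v \<le> C * norm v"
    and R_G: "\<And>v a. (v, a) \<in> G' \<Longrightarrow> R v = a"
    using hahn_banach_graph[of "\<lambda>v. C * norm v" G'] by blast
  define \<psi> where "\<psi> v = of_real (R v) - i * of_real (R (s i v))" for v
  have \<psi>_add: "\<psi> (v + w) = \<psi> v + \<psi> w" for v w
    by (simp add: \<psi>_def B.scale_right_distrib linear_add[OF R] algebra_simps)
  have R_real: "R (s (of_real r) v) = r * R v" for r v
    by (simp add: B.scale_of_real linear_scale[OF R])
  have \<psi>_real: "\<psi> (s (of_real r) v) = of_real r * \<psi> v" for r v
    by (simp add: \<psi>_def B.scale_left_commute[of i] R_real right_diff_distrib mult.left_commute del: B.scale_scale)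
  have \<psi>_i: "\<psi> (s i v) = i * \<psi> v" for v
    using i
  proof
    assume "i = 0"
    then show ?thesis
      by (simp add: \<psi>_def linear_0[OF R])
  next
    assume ii: "i * i = - 1"
    then have "s i (s i v) = - v"
      by simp
    moreover have "i * \<psi> v = i * of_real (R v) - (i * i) * of_real (R (s i v))"
      by (simp add: \<psi>_def algebra_simps)
    ultimately show ?thesis
      unfolding ii by (simp add: \<psi>_def linear_neg[OF R] del: B.scale_scale)
  qed
  have \<psi>_scale: "\<psi> (s c v) = c * \<psi> v" for c v
  proof -
    have "c = of_real (\<rho> c) + of_real (- \<rho> (i * c)) * i"
      by (rule trans[OF \<rho>_decomp]) (simp add: mult.commute)
    then have "s c v = s (of_real (\<rho> c) + of_real (- \<rho> (i * c)) * i) v"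
      by (rule arg_cong)
    also have "\<dots> = s (of_real (\<rho> c)) v + s (of_real (- \<rho> (i * c))) (s i v)"
      by (simp add: B.scale_left_distrib B.scale_left_diff_distrib)
    also have "\<psi> \<dots> = (of_real (\<rho> c) - i * of_real (\<rho> (i * c))) * \<psi> v"
      unfolding \<psi>_add \<psi>_real \<psi>_i by (simp add: algebra_simps)
    finally show ?thesis
      by (simp only: \<rho>_decomp[symmetric])
  qed
  have \<rho>_\<psi>: "\<rho> (\<psi> v) = R v" for v
    using \<rho>_of_real[of "R v" "- R (s i v)"] by (simp add: \<psi>_def)
  have \<psi>_le: "norm (\<psi> v) \<le> C * norm v" for v
  proof (cases "\<psi> v = 0")
    case False
    \<comment> \<open>\<open>u\<close> has norm 1 and rotates \<open>\<psi> v\<close> to a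
      nonnegative real, where \<open>\<psi>\<close> agrees with \<open>R\<close>; so the bound on
      \<open>R\<close> passes to \<open>\<psi>\<close> with the same constant.\<close>
    define u where "u = of_real (norm (\<psi> v)) / \<psi> v"
    have "\<rho> (\<psi> (s u v)) = norm (\<psi> v)"
      using False \<rho>_of_real[of "norm (\<psi> v)" 0] by (simp add: \<psi>_scale u_def)
    then have "norm (\<psi> v) \<le> C * norm (s u v)"
      using \<rho>_\<psi> R_le by metis
    also have "norm (s u v) = norm v"
      using False by (simp add: B.norm_scale u_def norm_divide)
    finally show ?thesis .
  qed (use \<open>0 \<le> C\<close> in simp)
  have "bounded_linear \<psi>"
  proof (rule bounded_linear_intro[of _ C])
    show "\<psi> (r *\<^sub>R v) = r *\<^sub>R \<psi> v" for r v
      using \<psi>_real[of r v] by (simp add: B.scale_of_real scaleR_conv_of_real)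
  qed (use \<psi>_add \<psi>_le in \<open>simp_all add: mult.commute\<close>)
  moreover have "Vector_Spaces.linear s (*) \<psi>"
  proof -
    interpret K: vector_space "(*) :: 'k \<Rightarrow> 'k \<Rightarrow> 'k"
      by unfold_locales (simp_all add: algebra_simps)
    show ?thesis
      by unfold_locales (simp_all add: \<psi>_add \<psi>_scale)
  qed
  moreover have "\<psi> v = a" if va: "(v, a) \<in> G" for v a
  proof -
    \<comment> \<open>Scaling the pair by \<open>i\<close> puts the real part of
      \<open>i * a\<close> on the graph as well, and the two real parts determine
      \<open>a\<close>.\<close>
    have "R v = \<rho> a" "R (s i v) = \<rho> (i * a)"
      using va scale[OF va, of i] by (force simp: G'_def intro!: R_G)+
    then have "\<psi> v = of_real (\<rho> a) - i * of_real (\<rho> (i * a))"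
      by (simp add: \<psi>_def)
    also have "\<dots> = a"
      by (rule \<rho>_decomp[symmetric])
    finally show ?thesis .
  qed
  ultimately show ?thesis
    using that \<psi>_le by (simp add: dual_space_def)
qed

section \<open>Weak mixing means and their comparison\<close>

text \<open>Naming the n-th term of the mixing condition reduces each implication to an inequality
  for fixed \<open>n\<close>.\<close>

definition weak_mean :: "('k::real_or_complex \<Rightarrow> 'v::banach \<Rightarrow> 'v) \<Rightarrow> (nat \<Rightarrow> 'v) \<Rightarrow> nat \<Rightarrow> real" where
  "weak_mean s z n = (SUP f\<in>dual_ball s. (1 / real n) * (\<Sum>k=1..n. norm (f (z k))))"

lemma dual_spaceD:
  assumes "f \<in> dual_space s"
  shows "f (v + w) = f v + f w" "f (s c v) = c * f v" "bounded_linear f"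
  using assms by (auto simp: dual_space_def Vector_Spaces.linear_iff)

lemma norm_dual_ball_le:
  assumes "f \<in> dual_ball s"
  shows "norm (f v) \<le> norm v"
proof -
  have "norm (f v) \<le> onorm f * norm v"
    using assms by (intro onorm) (auto simp: dual_ball_def dual_space_def)
  also have "\<dots> \<le> 1 * norm v"
    using assms by (intro mult_right_mono) (auto simp: dual_ball_def)
  finally show ?thesis by simp
qed

text \<open>Nonemptiness of the dual ball, required for upper estimates of the real supremum; the
  zero functional also witnesses that the means are nonnegative.\<close>

lemma zero_in_dual_ball:
  assumes "banach_space_over s"
  shows "(\<lambda>_. 0) \<in> dual_ball s"
proof -
  interpret banach_space_over s by (rule assms)
  interpret K: vector_space "(*) :: 'a \<Rightarrow> 'a \<Rightarrow> 'a"
    by unfold_locales (simp_all add: algebra_simps)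
  have "Vector_Spaces.linear s (*) (\<lambda>_. 0)"
    by unfold_locales simp_all
  then show ?thesis
    by (simp add: dual_ball_def dual_space_def onorm_zero)
qed

text \<open>A supremum of reals dominates its terms when they are bounded above. The bound
  \<open>B\<close> on the sequence ensures this, as functionals in the dual ball do not increase
  norms.\<close>

lemma weak_mean_upper:
  assumes "f \<in> dual_ball s" and "\<And>k. k \<ge> 1 \<Longrightarrow> norm (z k) \<le> B"
  shows "(1 / real n) * (\<Sum>k=1..n. norm (f (z k))) \<le> weak_mean s z n"
  unfolding weak_mean_def
proof (rule cSUP_upper[OF assms(1)])
  have "(1 / real n) * (\<Sum>k=1..n. norm (g (z k))) \<le> (1 / real n) * (\<Sum>k=1..n. B)" if "g \<in> dual_ball s" for g
    using norm_dual_ball_le[OF that] assms(2)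
    by (intro mult_left_mono sum_mono) (force intro: order_trans)+
  then show "bdd_above ((\<lambda>f. (1 / real n) * (\<Sum>k=1..n. norm (f (z k)))) ` dual_ball s)"
    unfolding bdd_above_def by blast
qed

lemma weak_mean_least:
  assumes "banach_space_over s" and "\<And>f. f \<in> dual_ball s \<Longrightarrow> (1 / real n) * (\<Sum>k=1..n. norm (f (z k))) \<le> K"
  shows "weak_mean s z n \<le> K"
  unfolding weak_mean_def using assms zero_in_dual_ball by (intro cSUP_least) blast+

lemma weak_mean_nonneg:
  assumes "banach_space_over s" and "\<And>k. k \<ge> 1 \<Longrightarrow> norm (z k) \<le> B"
  shows "0 \<le> weak_mean s z n"
  using weak_mean_upper[OF zero_in_dual_ball[OF assms(1)] assms(2)] by simp

text \<open>The means of \<open>z\<close> are squeezed between 0 and \<open>C\<close> times the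
  means of \<open>w\<close>.\<close>

lemma weak_mean_comparison:
  assumes "banach_space_over s" and "\<And>k. k \<ge> 1 \<Longrightarrow> norm (z k) \<le> B"
    and "\<And>n. weak_mean s z n \<le> C * weak_mean t w n"
    and "uniformly_weakly_mixing_to_zero t w"
  shows "uniformly_weakly_mixing_to_zero s z"
proof -
  have "(\<lambda>n. C * weak_mean t w n) \<longlonglongrightarrow> 0"
    using assms(4) by (auto simp: uniformly_weakly_mixing_to_zero_def weak_mean_def intro: tendsto_mult_right_zero)
  then have "(\<lambda>n. weak_mean s z n) \<longlonglongrightarrow> 0"
    by (rule tendsto_sandwich[OF _ _ tendsto_const, rotated 2])
      (auto intro!: always_eventually assms(3) weak_mean_nonneg[OF assms(1,2)])
  then show ?thesis
    by (simp add: uniformly_weakly_mixing_to_zero_def weak_mean_def)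
qed


section \<open>Elementary tensors and finiteness of the conjugate norm\<close>

text \<open>Equality holds as HOL functions because every term takes the default value 0 off the
  bilinear forms.\<close>

lemma elem_tensor_add:
  "elem_tensor sX sY (x + x') y = (\<lambda>b. elem_tensor sX sY x y b + elem_tensor sX sY x' y b)"
  by (auto simp: elem_tensor_def bilinear_form_def Vector_Spaces.linear_iff)

lemma elem_tensor_scale:
  "elem_tensor sX sY (sX c x) y = (\<lambda>b. c * elem_tensor sX sY x y b)"
  by (auto simp: elem_tensor_def bilinear_form_def Vector_Spaces.linear_iff)

lemma elem_tensor_in_alg_tensor: "elem_tensor sX sY x y \<in> alg_tensor sX sY"
  unfolding alg_tensor_def
  by (auto intro!: exI[of _ "1::nat"] exI[of _ "\<lambda>_. x"] exI[of _ "\<lambda>_. y"])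

text \<open>The weights are absorbed into the first factors. The inclusion makes the finiteness
  clause of \<open>conj_cross_norm\<close> available for approximants from
  \<open>ball_alg_tensor\<close>.\<close>

lemma ball_alg_tensor_subset: "ball_alg_tensor sX sY \<subseteq> dual_alg_tensor sX sY"
proof
  fix \<phi> assume "\<phi> \<in> ball_alg_tensor sX sY"
  then obtain n c f g where fg: "\<forall>k<(n::nat). f k \<in> dual_ball sX \<and> g k \<in> dual_ball sY \<and> (0::real) \<le> c k"
    and \<phi>: "\<phi> = (\<lambda>u. \<Sum>k<n. of_real (c k) * elem_functional sX sY (f k) (g k) u)"
    unfolding ball_alg_tensor_def by blast
  have scale: "(\<lambda>x. of_real (c k) * f k x) \<in> dual_space sX" if "k < n" for k
    using fg that bounded_linear_const_mult
    by (fastforce simp: dual_ball_def dual_space_def Vector_Spaces.linear_iff algebra_simps)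
  have "of_real (c k) * elem_functional sX sY (f k) (g k) u =
      elem_functional sX sY (\<lambda>x. of_real (c k) * f k x) (g k) u" if "k < n" for k u
  proof (cases "u \<in> alg_tensor sX sY")
    case True
    \<comment> \<open>Evaluation of a tensor is homogeneous only among genuine bilinear forms, so
      both must be shown bilinear before the scalar can be pulled out.\<close>
    have "bilinear_form sX sY (\<lambda>x y. f k x * g k y)"
      "bilinear_form sX sY (\<lambda>x y. of_real (c k) * f k x * g k y)"
      using fg that by (auto simp: bilinear_form_def dual_ball_def dual_space_def Vector_Spaces.linear_iff algebra_simps)
    with True show ?thesis
      by (auto simp: elem_functional_def alg_tensor_def elem_tensor_def sum_distrib_left mult.assoc)
  qed (simp add: elem_functional_def)
  then have "\<phi> = (\<lambda>u. \<Sum>k<n. elem_functional sX sY (\<lambda>x. of_real (c k) * f k x) (g k) u)"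
    unfolding \<phi> by (intro ext sum.cong) auto
  moreover have "g k \<in> dual_space sY" if "k < n" for k
    using fg that by (simp add: dual_ball_def)
  ultimately show "\<phi> \<in> dual_alg_tensor sX sY"
    unfolding dual_alg_tensor_def using scale
    by (intro CollectI exI[of _ n] exI[of _ "\<lambda>k x. of_real (c k) * f k x"] exI[of _ g]) simp
qed

text \<open>The difference need not lie in \<open>dual_alg_tensor\<close>, so boundedness of its
  supremum is checked directly: the first part is at most 1 because \<open>\<iota>\<close> is
  isometric, the second is bounded by the finiteness of the conjugate norm.\<close>

lemma conj_norm_upper:
  assumes "is_completion (alg_tensor sX sY) \<alpha> sW \<iota>" "conj_cross_norm sX sY \<alpha>"
    and "\<psi> \<in> dual_ball sW" "\<phi> \<in> dual_alg_tensor sX sY" "u \<in> alg_tensor sX sY" "\<alpha> u \<le> 1"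
  shows "norm (\<psi> (\<iota> u) - \<phi> u) \<le> conj_norm sX sY \<alpha> (\<lambda>u. \<psi> (\<iota> u) - \<phi> u)"
  unfolding conj_norm_def
proof (rule cSUP_upper)
  obtain D where D: "\<And>v. v \<in> alg_tensor sX sY \<Longrightarrow> \<alpha> v \<le> 1 \<Longrightarrow> norm (\<phi> v) \<le> D"
    using assms(2,4) unfolding conj_cross_norm_def bdd_above_def by fast
  have "norm (\<psi> (\<iota> v) - \<phi> v) \<le> 1 + D" if "v \<in> alg_tensor sX sY" "\<alpha> v \<le> 1" for v
    using D[OF that] norm_dual_ball_le[OF assms(3), of "\<iota> v"] that assms(1)
      norm_triangle_ineq4[of "\<psi> (\<iota> v)" "\<phi> v"]
    by (auto simp: is_completion_def)
  then show "bdd_above ((\<lambda>u. norm (\<psi> (\<iota> u) - \<phi> u)) ` {u \<in> alg_tensor sX sY. \<alpha> u \<le> 1})"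
    unfolding bdd_above_def by blast
qed (use assms in simp)

section \<open>Estimates between the means of a sequence and of its tensors\<close>

lemma weak_mean_elem_tensor_le:
  fixes sX :: "'k::real_or_complex \<Rightarrow> 'x::banach \<Rightarrow> 'x"
    and sY :: "'k \<Rightarrow> 'y::banach \<Rightarrow> 'y"
    and sW :: "'k \<Rightarrow> 'w::banach \<Rightarrow> 'w"
  assumes X: "banach_space_over sX" and Y: "banach_space_over sY"
    and cross: "cross_norm sX sY \<alpha>" and conj: "conj_cross_norm sX sY \<alpha>"
    and comp: "is_completion (alg_tensor sX sY) \<alpha> sW \<iota>"
    and ball: "dual_ball sW \<subseteq> ball_tensor_closure sX sY \<alpha> sW \<iota>"
    and x: "\<And>k. k \<ge> 1 \<Longrightarrow> norm (x k) \<le> B" "0 < B"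
    and y: "\<And>k. k \<ge> 1 \<Longrightarrow> norm (y k) \<le> M" "0 < M"
  shows "weak_mean sW (\<lambda>k. \<iota> (elem_tensor sX sY (x k) (y k))) n \<le> M * weak_mean sX x n"
proof (rule weak_mean_least)
  show W: "banach_space_over sW"
    using comp by (simp add: is_completion_def)
  fix \<psi> assume \<psi>: "\<psi> \<in> dual_ball sW"
  let ?t = "\<lambda>k. elem_tensor sX sY (x k) (y k)"
  show "(1 / real n) * (\<Sum>k=1..n. norm (\<psi> (\<iota> (?t k)))) \<le> M * weak_mean sX x n"
  proof (rule field_le_epsilon)
    fix e :: real assume "0 < e"
    \<comment> \<open>The tensors have norm at most \<open>B * M\<close>, so an error
      \<open>\<epsilon>\<close> on the unit ball becomes \<open>e\<close> on them.\<close>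
    define \<epsilon> where "\<epsilon> = e / (B * M)"
    have "\<epsilon> > 0"
      using \<open>0 < e\<close> x y by (simp add: \<epsilon>_def)
    then obtain \<phi> where \<phi>: "\<phi> \<in> ball_alg_tensor sX sY"
      and close: "conj_norm sX sY \<alpha> (\<lambda>u. \<psi> (\<iota> u) - \<phi> u) < \<epsilon>"
      using ball \<psi> unfolding ball_tensor_closure_def by blast
    obtain m c f g where fg: "\<And>j. j < (m::nat) \<Longrightarrow> f j \<in> dual_ball sX" "\<And>j. j < m \<Longrightarrow> g j \<in> dual_ball sY"
      and c: "\<And>j. j < m \<Longrightarrow> (0::real) \<le> c j" "(\<Sum>j<m. c j) \<le> 1"
      and \<phi>_eq: "\<phi> = (\<lambda>u. \<Sum>j<m. of_real (c j) * elem_functional sX sY (f j) (g j) u)"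
      using \<phi> unfolding ball_alg_tensor_def by blast
    have \<phi>_elem: "\<phi> (elem_tensor sX sY v w) = (\<Sum>j<m. of_real (c j) * (f j v * g j w))" for v w
      unfolding \<phi>_eq using fg
      by (intro sum.cong refl) (simp add: elem_functional_elem_tensor[OF X Y] dual_ball_def)
    have \<psi>_le: "norm (\<psi> (\<iota> (?t k))) \<le> (\<Sum>j<m. c j * (M * norm (f j (x k)))) + e" if "k \<ge> 1" for k
    proof -
      \<comment> \<open>\<open>close\<close> only controls the unit ball of \<open>\<alpha>\<close>, hence the rescaling.\<close>
      let ?r = "inverse (B * M)"
      let ?u = "elem_tensor sX sY (sX (of_real ?r) (x k)) (y k)"
      have u: "?u = (\<lambda>b. of_real ?r * ?t k b)"
        by (rule elem_tensor_scale)
      have "\<alpha> ?u = ?r * (norm (x k) * norm (y k))"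
        using cross x y
        by (simp add: cross_norm_def banach_space_over.norm_scale[OF X] norm_mult norm_inverse)
      also have "\<dots> \<le> ?r * (B * M)"
        using x y that by (intro mult_left_mono mult_mono) auto
      also have "\<dots> = 1"
        using x(2) y(2) by (intro left_inverse) simp
      finally have "\<alpha> ?u \<le> 1" .
      then have "norm (\<psi> (\<iota> ?u) - \<phi> ?u) < \<epsilon>"
        using conj_norm_upper[OF comp conj \<psi>, of \<phi> ?u] close ball_alg_tensor_subset \<phi>
        by (meson elem_tensor_in_alg_tensor le_less_trans subset_iff)
      also have "\<psi> (\<iota> ?u) = of_real ?r * \<psi> (\<iota> (?t k))"
        using comp \<psi> unfolding u
        by (simp add: is_completion_def elem_tensor_in_alg_tensor dual_ball_def dual_spaceD)
      also have "\<phi> ?u = of_real ?r * \<phi> (?t k)"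
        unfolding \<phi>_elem sum_distrib_left using fg
        by (intro sum.cong refl) (simp add: dual_ball_def dual_spaceD)
      also have "norm (of_real ?r * \<psi> (\<iota> (?t k)) - of_real ?r * \<phi> (?t k)) = ?r * norm (\<psi> (\<iota> (?t k)) - \<phi> (?t k))"
        unfolding right_diff_distrib[symmetric] using x y by (simp add: norm_mult norm_inverse)
      finally have "norm (\<psi> (\<iota> (?t k)) - \<phi> (?t k)) < e"
        using x y by (simp add: \<epsilon>_def field_simps)
      moreover have "norm (\<phi> (?t k)) \<le> (\<Sum>j<m. c j * (M * norm (f j (x k))))"
        unfolding \<phi>_elem
      proof (rule sum_norm_le)
        fix j assume j: "j \<in> {..<m}"
        have "norm (g j (y k)) \<le> M"
          using norm_dual_ball_le[OF fg(2), of j "y k"] j y(1)[OF that] by simp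
        then show "norm (of_real (c j) * (f j (x k) * g j (y k))) \<le> c j * (M * norm (f j (x k)))"
          using c(1)[of j] j by (simp add: norm_mult) (metis mult.commute mult_left_mono norm_ge_zero)
      qed
      ultimately show ?thesis
        using norm_triangle_sub[of "\<psi> (\<iota> (?t k))" "\<phi> (?t k)"] by linarith
    qed
    have "(1 / real n) * (\<Sum>k=1..n. norm (\<psi> (\<iota> (?t k))))
        \<le> (1 / real n) * (\<Sum>k=1..n. (\<Sum>j<m. c j * (M * norm (f j (x k)))) + e)"
      by (intro mult_left_mono sum_mono \<psi>_le) auto
    \<comment> \<open>Exchanging the sums leaves, for each \<open>j\<close>, the mean of the single
      functional \<open>f j\<close>, which \<open>weak_mean_upper\<close> controls uniformly in
      \<open>j\<close>.\<close>
    also have "\<dots> = (\<Sum>j<m. c j * (M * ((1 / real n) * (\<Sum>k=1..n. norm (f j (x k)))))) + (1 / real n) * (real n * e)"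
      by (simp add: sum.distrib distrib_left sum_distrib_left sum_divide_distrib) (rule sum.swap)
    \<comment> \<open>The averaged error is \<open>e\<close> for positive \<open>n\<close>, but 0
      for \<open>n = 0\<close> because \<open>1 / 0 = 0\<close>.\<close>
    also have "\<dots> \<le> (\<Sum>j<m. c j * (M * weak_mean sX x n)) + e"
      using c(1) y(2) \<open>0 < e\<close>
      by (intro add_mono sum_mono mult_left_mono weak_mean_upper[where B = B] fg x(1)) auto
    also have "\<dots> = (\<Sum>j<m. c j) * (M * weak_mean sX x n) + e"
      by (simp add: sum_distrib_right)
    \<comment> \<open>Raising the total weight to 1 is allowed because the mean of \<open>x\<close>
      is nonnegative.\<close>
    also have "\<dots> \<le> 1 * (M * weak_mean sX x n) + e"
      using c(2) y(2) weak_mean_nonneg[OF X x(1), where n=n] by (intro add_mono mult_right_mono) auto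
    finally show "(1 / real n) * (\<Sum>k=1..n. norm (\<psi> (\<iota> (?t k)))) \<le> M * weak_mean sX x n + e"
      by simp
  qed
qed

lemma weak_mean_le_elem_tensor:
  fixes sX :: "'k::real_or_complex \<Rightarrow> 'x::banach \<Rightarrow> 'x"
    and sY :: "'k \<Rightarrow> 'y::banach \<Rightarrow> 'y"
    and sW :: "'k \<Rightarrow> 'w::banach \<Rightarrow> 'w"
  assumes X: "banach_space_over sX"
    and cross: "cross_norm sX sY \<alpha>"
    and comp: "is_completion (alg_tensor sX sY) \<alpha> sW \<iota>"
    and x: "\<And>k. k \<ge> 1 \<Longrightarrow> norm (x k) \<le> B" and "y \<noteq> 0"
  shows "weak_mean sX x n \<le> inverse (norm y) * weak_mean sW (\<lambda>k. \<iota> (elem_tensor sX sY (x k) y)) n"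
proof (rule weak_mean_least[OF X])
  let ?t = "\<lambda>v. elem_tensor sX sY v y"
  have W: "banach_space_over sW"
    using comp by (simp add: is_completion_def)
  have norm_t: "norm (\<iota> (?t v)) = norm v * norm y" for v
    using comp cross by (simp add: is_completion_def cross_norm_def elem_tensor_in_alg_tensor)
  have t_add: "\<iota> (?t (v + w)) = \<iota> (?t v) + \<iota> (?t w)" for v w
    using comp by (simp add: elem_tensor_add is_completion_def elem_tensor_in_alg_tensor)
  have t_scale: "\<iota> (?t (sX c v)) = sW c (\<iota> (?t v))" for c v
    using comp by (simp add: elem_tensor_scale is_completion_def elem_tensor_in_alg_tensor)
  fix f assume f: "f \<in> dual_ball sX"
  then have f_dual: "f \<in> dual_space sX"
    by (simp add: dual_ball_def)
  \<comment> \<open>The cross-norm identity multiplies norms by \<open>norm y\<close> when passing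
    from \<open>v\<close> to \<open>\<iota> (?t v)\<close>; the same factor on \<open>f\<close>
    gives the graph the bound 1, and it is divided out at the end.\<close>
  let ?a = "\<lambda>v. f v * of_real (norm y)"
  define G where "G = range (\<lambda>v. (\<iota> (?t v), ?a v))"
  have "(0, 0) \<in> G"
  proof -
    have "\<iota> (?t 0) = 0" "f 0 = 0"
      using norm_t[of 0] linear_0[OF bounded_linear.linear[OF dual_spaceD(3)[OF f_dual]]] by auto
    moreover have "(\<iota> (?t 0), ?a 0) \<in> G"
      unfolding G_def by (rule rangeI)
    ultimately show ?thesis by simp
  qed
  moreover have "(v + w, a + b) \<in> G" if "(v, a) \<in> G" "(w, b) \<in> G" for v w a b
    using that unfolding G_def
    by (auto simp flip: t_add distrib_right dual_spaceD(1)[OF f_dual])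
  moreover have "(sW c v, c * a) \<in> G" if va: "(v, a) \<in> G" for c v a
  proof -
    obtain v' where "v = \<iota> (?t v')" "a = ?a v'"
      using va unfolding G_def by auto
    then have "(sW c v, c * a) = (\<iota> (?t (sX c v')), ?a (sX c v'))"
      by (simp add: t_scale dual_spaceD(2)[OF f_dual] mult.assoc)
    then show ?thesis
      unfolding G_def by blast
  qed
  moreover have "norm a \<le> 1 * norm v" if "(v, a) \<in> G" for v a
    using that norm_dual_ball_le[OF f]
    by (auto simp: G_def norm_t norm_mult mult_right_mono)
  ultimately obtain \<psi> where \<psi>: "\<psi> \<in> dual_space sW" "\<And>v. norm (\<psi> v) \<le> 1 * norm v"
    and \<psi>_G: "\<And>v a. (v, a) \<in> G \<Longrightarrow> \<psi> v = a"
    using hahn_banach_over[OF W, of 1 G] by (metis zero_le_one)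
  have "\<psi> \<in> dual_ball sW"
    using \<psi> onorm_bound[of 1 \<psi>] by (simp add: dual_ball_def)
  then have "(1 / real n) * (\<Sum>k=1..n. norm (\<psi> (\<iota> (?t (x k))))) \<le> weak_mean sW (\<lambda>k. \<iota> (?t (x k))) n"
    by (rule weak_mean_upper[where B = "B * norm y"]) (simp add: norm_t x mult_right_mono)
  moreover have "\<psi> (\<iota> (?t v)) = ?a v" for v
    by (rule \<psi>_G) (unfold G_def, rule rangeI)
  ultimately show "(1 / real n) * (\<Sum>k=1..n. norm (f (x k))) \<le> inverse (norm y) * weak_mean sW (\<lambda>k. \<iota> (?t (x k))) n"
    using \<open>y \<noteq> 0\<close> by (simp add: norm_mult sum_distrib_left field_simps)
qed

section \<open>From the termwise estimates to the equivalence\<close>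

theorem theorem2p3:
  fixes sX :: "'k::real_or_complex \<Rightarrow> 'x::banach \<Rightarrow> 'x"
    and sY :: "'k \<Rightarrow> 'y::banach \<Rightarrow> 'y"
    and sW :: "'k \<Rightarrow> 'w::banach \<Rightarrow> 'w"
    and \<alpha> :: "('k, 'x, 'y) tensor \<Rightarrow> real"
    and \<iota> :: "('k, 'x, 'y) tensor \<Rightarrow> 'w"
    and x :: "nat \<Rightarrow> 'x"
  assumes "banach_space_over sX" and "banach_space_over sY"
    and "\<exists>y::'y. y \<noteq> 0"
    and "cross_norm sX sY \<alpha>"
    and "conj_cross_norm sX sY \<alpha>"
    and "is_completion (alg_tensor sX sY) \<alpha> sW \<iota>"
    and "ball_tensor_closure sX sY \<alpha> sW \<iota> = dual_ball sW"
    and "bounded (x ` {1..})"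
  shows "(\<forall>y :: nat \<Rightarrow> 'y. bounded (y ` {1..}) \<longrightarrow>
            uniformly_weakly_mixing_to_zero sW (\<lambda>k. \<iota> (elem_tensor sX sY (x k) (y k)))) \<longleftrightarrow>
         uniformly_weakly_mixing_to_zero sX x"
proof (intro iffI allI impI)
  obtain B where B: "0 < B" "\<And>k. k \<ge> 1 \<Longrightarrow> norm (x k) \<le> B"
    using assms(8) unfolding bounded_pos by auto
  {
    assume *: "\<forall>y :: nat \<Rightarrow> 'y. bounded (y ` {1..}) \<longrightarrow>
            uniformly_weakly_mixing_to_zero sW (\<lambda>k. \<iota> (elem_tensor sX sY (x k) (y k)))"
    obtain y :: 'y where "y \<noteq> 0"
      using assms(3) by blast
    have "bounded ((\<lambda>k::nat. y) ` {1..})"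
      by (rule finite_imp_bounded) (simp add: image_constant_conv)
    with * have "uniformly_weakly_mixing_to_zero sW (\<lambda>k. \<iota> (elem_tensor sX sY (x k) y))"
      by blast
    \<comment> \<open>The comparison constant here is \<open>inverse (norm y)\<close>; in the
      converse direction it is the bound \<open>M\<close> of the second factors.\<close>
    with weak_mean_le_elem_tensor[OF assms(1,4,6) B(2) \<open>y \<noteq> 0\<close>]
    show "uniformly_weakly_mixing_to_zero sX x"
      by (intro weak_mean_comparison[OF assms(1) B(2)])
  }
  fix y :: "nat \<Rightarrow> 'y"
  assume x: "uniformly_weakly_mixing_to_zero sX x" and "bounded (y ` {1..})"
  then obtain M where M: "0 < M" "\<And>k. k \<ge> 1 \<Longrightarrow> norm (y k) \<le> M"
    unfolding bounded_pos by auto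
  have W: "banach_space_over sW"
    using assms(6) by (simp add: is_completion_def)
  have bound: "norm (\<iota> (elem_tensor sX sY (x k) (y k))) \<le> B * M" if "k \<ge> 1" for k
    using assms(4,6) B M that
    by (simp add: is_completion_def cross_norm_def elem_tensor_in_alg_tensor mult_mono)
  show "uniformly_weakly_mixing_to_zero sW (\<lambda>k. \<iota> (elem_tensor sX sY (x k) (y k)))"
  proof (rule weak_mean_comparison[OF W bound])
    show "weak_mean sW (\<lambda>k. \<iota> (elem_tensor sX sY (x k) (y k))) n \<le> M * weak_mean sX x n" for n
      using assms(7) by (intro weak_mean_elem_tensor_le[OF assms(1,2,4,5,6) _ B(2,1) M(2,1)]) simp_all
  qed (use x in simp_all)
qed

end
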